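(* Let $k\geq 2$ and let $X$ be a $k$-connected multigraph. Then the complete generalized truncation $Y$ of $X$ is $k$-connected.
   Context: A multigraph may have multiple edges but no loops; it is assumed to have no isolated vertices. Generalized truncation of $X$: take a matching $M_0$ with $|M_0|=|E(X)|$ (on $2|E(X)|$ new vertices) and a bijection $F:E(X)\to M_0$; for each edge $e$ of $X$ with ends $u,v$, label one end of $F(e)$ by $u$ and the other by $v$. For $v\in V(X)$, the cluster $\mathrm{cl}(v)$ is the set of vertices labelled $v$; insert a graph $\mathrm{con}(v)$ (constituent) on $\mathrm{cl}(v)$. The result $F(M_0)\cup\bigcup_v\mathrm{con}(v)$ is a generalized truncation; it is complete if every constituent is a complete graph. A multigraph is $k$-connected if every pair of distinct vertices is joined by $k$ internally disjoint paths. *)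

theory Defs
  imports Main "HOL-Library.Disjoint_Sets"
begin

record ('v, 'e) mgraph =
  verts :: "'v set"
  edges :: "'e set"
  ends :: "'e \<Rightarrow> 'v set"

definition multigraph :: "('v, 'e) mgraph \<Rightarrow> bool" where
  "multigraph X \<longleftrightarrow>
     (\<forall>e\<in>edges X. ends X e \<subseteq> verts X \<and> card (ends X e) = 2) \<and>
     (\<forall>v\<in>verts X. \<exists>e\<in>edges X. v \<in> ends X e)"

text \<open>
  A path is a pair of its vertex sequence and its edge sequence, so that paths with the
  same vertices running through different parallel edges are different paths.
\<close>

definition is_path :: "('v, 'e) mgraph \<Rightarrow> 'v \<Rightarrow> 'v list \<times> 'e list \<Rightarrow> 'v \<Rightarrow> bool" where
  "is_path X u p v \<longleftrightarrow> (case p of (vs, es) \<Rightarrow>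
     length vs = Suc (length es) \<and> distinct vs \<and> set vs \<subseteq> verts X \<and> set es \<subseteq> edges X \<and>
     hd vs = u \<and> last vs = v \<and>
     (\<forall>i<length es. ends X (es ! i) = {vs ! i, vs ! Suc i}))"

definition internal_verts :: "'v list \<times> 'e list \<Rightarrow> 'v set" where
  "internal_verts p = set (fst p) - {hd (fst p), last (fst p)}"

text \<open>
  The \<open>k\<close> paths are the elements of a set, hence different from each other; in particular
  each edge joining \<open>u\<close> and \<open>v\<close> contributes at most one path.
\<close>

definition k_connected :: "nat \<Rightarrow> ('v, 'e) mgraph \<Rightarrow> bool" where
  "k_connected k X \<longleftrightarrow>
     (\<forall>u\<in>verts X. \<forall>v\<in>verts X. u \<noteq> v \<longrightarrow>
       (\<exists>P. finite P \<and> card P = k \<and> (\<forall>p\<in>P. is_path X u p v) \<and>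
            (\<forall>p\<in>P. \<forall>q\<in>P. p \<noteq> q \<longrightarrow> internal_verts p \<inter> internal_verts q = {})))"

definition matching :: "'w set set \<Rightarrow> bool" where
  "matching M \<longleftrightarrow> (\<forall>m\<in>M. card m = 2) \<and> disjoint M"

definition complete_edges :: "'w set \<Rightarrow> 'w set set" where
  "complete_edges A = {m. m \<subseteq> A \<and> card m = 2}"

definition cluster :: "'w set set \<Rightarrow> ('w \<Rightarrow> 'v) \<Rightarrow> 'v \<Rightarrow> 'w set" where
  "cluster M lab v = {w \<in> \<Union>M. lab w = v}"

text \<open>
  \<open>M\<close> is the edge set of the matching, whose vertex set is \<open>\<Union>M\<close>; \<open>lab\<close> is the labelling of its
  vertices by the vertices of \<open>X\<close>; \<open>con v\<close> is the edge set of the constituent at \<open>v\<close>, a graph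
  with vertex set \<open>cluster M lab v\<close>. The edges of \<open>Y\<close> are two-element sets of vertices: as \<open>X\<close> has
  no loops, no edge of the matching has both ends in one cluster, so the union creates no
  parallel edges that would be identified here.
\<close>

definition truncation_data ::
  "('v, 'e) mgraph \<Rightarrow> 'w set set \<Rightarrow> ('e \<Rightarrow> 'w set) \<Rightarrow> ('w \<Rightarrow> 'v) \<Rightarrow> ('v \<Rightarrow> 'w set set)
     \<Rightarrow> ('w, 'w set) mgraph \<Rightarrow> bool" where
  "truncation_data X M F lab con Y \<longleftrightarrow>
     matching M \<and> bij_betw F (edges X) M \<and>
     (\<forall>e\<in>edges X. bij_betw lab (F e) (ends X e)) \<and>
     (\<forall>v\<in>verts X. con v \<subseteq> complete_edges (cluster M lab v)) \<and>
     Y = \<lparr>verts = \<Union>M, edges = M \<union> (\<Union>v\<in>verts X. con v), ends = (\<lambda>m. m)\<rparr>"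

definition generalized_truncation :: "('v, 'e) mgraph \<Rightarrow> ('w, 'w set) mgraph \<Rightarrow> bool" where
  "generalized_truncation X Y \<longleftrightarrow> (\<exists>M F lab con. truncation_data X M F lab con Y)"

definition complete_generalized_truncation ::
  "('v, 'e) mgraph \<Rightarrow> ('w, 'w set) mgraph \<Rightarrow> bool" where
  "complete_generalized_truncation X Y \<longleftrightarrow>
     (\<exists>M F lab con. truncation_data X M F lab con Y \<and>
        (\<forall>v\<in>verts X. con v = complete_edges (cluster M lab v)))"

lemma complete_generalized_truncation_exists:
  fixes X :: "('v, 'e) mgraph"
  assumes "multigraph X"
  shows "\<exists>Y :: ('e \<times> 'v, ('e \<times> 'v) set) mgraph. complete_generalized_truncation X Y"
proof -
  define F where "F = (\<lambda>e. {e} \<times> ends X e)"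
  define M where "M = F ` edges X"
  have c: "card (ends X e) = 2" if "e \<in> edges X" for e
    using assms that by (auto simp: multigraph_def)
  have "inj_on F (edges X)"
  proof (rule inj_onI)
    fix e f assume e: "e \<in> edges X" and eq: "F e = F f"
    obtain x where "x \<in> ends X e" using c[OF e] by fastforce
    then have "(e, x) \<in> F e" by (simp add: F_def)
    then have "(e, x) \<in> F f" using eq by simp
    then show "e = f" by (simp add: F_def)
  qed
  then have "bij_betw F (edges X) M" by (simp add: M_def bij_betw_def)
  moreover have "matching M"
    unfolding matching_def M_def
    by (auto simp: F_def card_cartesian_product c disjoint_def)
  moreover have "bij_betw snd (F e) (ends X e)" for e
    by (auto simp: F_def bij_betw_def inj_on_def image_iff)
  ultimately have "truncation_data X M F snd (\<lambda>v. complete_edges (cluster M snd v))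
      \<lparr>verts = \<Union>M, edges = M \<union> (\<Union>v\<in>verts X. complete_edges (cluster M snd v)),
       ends = (\<lambda>m. m)\<rparr>"
    by (simp add: truncation_data_def)
  then show ?thesis
    unfolding complete_generalized_truncation_def
    by (intro exI conjI ballI) (assumption, rule refl)
qed

end

theory Submission
  imports Defs
begin

text \<open>
  Internally disjoint paths of \<open>X\<close> between two vertices are also edge-disjoint. The matching edges
  of a path of \<open>X\<close> from \<open>u\<close> to \<open>v\<close>, together with cluster edges, connect any \<open>x\<close> in the cluster of
  \<open>u\<close> to any \<open>y\<close> in the cluster of \<open>v\<close>, and edge-disjoint paths of \<open>X\<close> use disjoint sets of vertices
  of \<open>Y\<close> apart from \<open>x\<close> and \<open>y\<close>. If \<open>x\<close> and \<open>y\<close> lie in the same cluster, of a vertex \<open>v\<close>, that cluster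
  has at least \<open>k\<close> vertices and so provides the edge \<open>xy\<close> and \<open>k - 2\<close> paths of length two; one more
  path leaves the cluster through the matching edges at \<open>x\<close> and \<open>y\<close> and follows a path of \<open>X\<close> that
  avoids \<open>v\<close>, which exists because \<open>k \<ge> 2\<close>.
\<close>

section \<open>Paths from reachability\<close>

text \<open>Both the vertices and the edges are restricted: the sets \<open>S\<close> of different
  paths make them internally disjoint, and the sets \<open>E\<close> control which of them may use
  the edge joining their common ends. Through the reflexive transitive closure routes are composed
  without regard to repeated vertices.\<close>

definition adj_within :: "'w set \<Rightarrow> 'w set set \<Rightarrow> ('w \<times> 'w) set" where
  "adj_within S E = {(a, b). a \<in> S \<and> b \<in> S \<and> {a, b} \<in> E}"

lemma adj_within_mono:
  "S \<subseteq> S' \<Longrightarrow> E \<subseteq> E' \<Longrightarrow> adj_within S E \<subseteq> adj_within S' E'"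
  by (auto simp: adj_within_def)

text \<open>Each step either appends a new vertex or, if that vertex already lies on the walk, cuts
  the walk back to it.\<close>

lemma distinct_walk_from_reachability:
  assumes "(x, y) \<in> (adj_within S E)\<^sup>*" "x \<in> S"
  shows "\<exists>ws. ws \<noteq> [] \<and> hd ws = x \<and> last ws = y \<and> distinct ws \<and> set ws \<subseteq> S \<and>
    successively (\<lambda>a b. {a, b} \<in> E) ws"
  using assms
proof (induction rule: rtrancl_induct)
  case base
  then show ?case by (intro exI[of _ "[x]"]) auto
next
  case (step y z)
  then obtain ws where ws: "ws \<noteq> []" "hd ws = x" "last ws = y" "distinct ws" "set ws \<subseteq> S"
    "successively (\<lambda>a b. {a, b} \<in> E) ws" by blast
  have z: "z \<in> S" "{y, z} \<in> E" using step.hyps by (auto simp: adj_within_def)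
  show ?case
  proof (cases "z \<in> set ws")
    case True
    then obtain as bs where ab: "ws = as @ z # bs" by (auto dest: split_list)
    have "successively (\<lambda>a b. {a, b} \<in> E) (as @ [z])"
      using ws(6) unfolding ab by (auto simp: successively_append_iff)
    moreover have "hd (as @ [z]) = x" using ws(2) ab by (cases as) auto
    ultimately show ?thesis
      using ws ab by (intro exI[of _ "as @ [z]"]) auto
  next
    case False
    then show ?thesis
      using ws z by (intro exI[of _ "ws @ [z]"]) (auto simp: successively_append_iff)
  qed
qed

lemma path_from_reachability:
  fixes Y :: "('w, 'w set) mgraph"
  assumes "ends Y = (\<lambda>m. m)" "S \<subseteq> verts Y" "E \<subseteq> edges Y"
    and "(x, y) \<in> (adj_within S E)\<^sup>*" "x \<in> S"
  shows "\<exists>p. is_path Y x p y \<and> set (fst p) \<subseteq> S \<and> set (snd p) \<subseteq> E"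
proof -
  obtain ws where ws: "ws \<noteq> []" "hd ws = x" "last ws = y" "distinct ws" "set ws \<subseteq> S"
    "successively (\<lambda>a b. {a, b} \<in> E) ws"
    using distinct_walk_from_reachability[OF assms(4,5)] by blast
  \<comment> \<open>Edges of \<open>Y\<close> are their own sets of ends, so the vertex sequence
    determines the edge sequence.\<close>
  define es where "es = map (\<lambda>i. {ws ! i, ws ! Suc i}) [0..<length ws - 1]"
  have "set es \<subseteq> E"
    using ws(6) by (auto simp: es_def successively_conv_nth)
  moreover have "is_path Y x (ws, es) y"
  proof -
    have "set es \<subseteq> edges Y" using \<open>set es \<subseteq> E\<close> assms(3) by simp
    moreover have "length ws = Suc (length es)" using ws(1) by (simp add: es_def)
    moreover have "es ! i = {ws ! i, ws ! Suc i}" if "i < length es" for i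
      using that by (simp add: es_def)
    ultimately show ?thesis using ws assms(1,2) by (auto simp: is_path_def)
  qed
  ultimately show ?thesis using ws(5) by (intro exI[of _ "(ws, es)"]) auto
qed

lemma is_path_internal_verts: "is_path X u p v \<Longrightarrow> internal_verts p = set (fst p) - {u, v}"
  by (auto simp: is_path_def internal_verts_def split: prod.splits)

text \<open>The second vertex of the path differs from \<open>x\<close> and is not internal, so it
  is \<open>y\<close>, and the first edge is \<open>{x, y}\<close>.\<close>

lemma is_path_no_internal_verts:
  assumes "is_path Y x p y" "x \<noteq> y" "internal_verts p = {}" "ends Y = (\<lambda>m. m)"
  shows "{x, y} \<in> set (snd p)"
proof -
  obtain vs es where p: "p = (vs, es)" by force
  have d: "length vs = Suc (length es)" "distinct vs" "hd vs = x" "last vs = y"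
    "\<And>i. i < length es \<Longrightarrow> es ! i = {vs ! i, vs ! Suc i}"
    using assms(1,4) by (auto simp: is_path_def p)
  have es: "es \<noteq> []"
    using d assms(2) by (cases vs) auto
  have ne: "vs \<noteq> []" using d(1) by auto
  have x: "vs ! 0 = x" using d(3) ne by (simp add: hd_conv_nth)
  have "vs ! 1 \<in> set vs" using d(1) es by (auto intro!: nth_mem)
  moreover have "vs ! 1 \<noteq> vs ! 0" using d(1,2) es by (subst nth_eq_iff_index_eq) auto
  ultimately have "vs ! 1 = y"
    using assms(3) d(3,4) x by (auto simp: internal_verts_def p)
  then have "es ! 0 = {x, y}" using d(5)[of 0] es x by simp
  moreover have "es ! 0 \<in> set es" using es by simp
  ultimately show ?thesis by (simp add: p)
qed

text \<open>Different indices must yield different paths. A path chosen for two indices would be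
  internally disjoint from itself, hence run along the edge \<open>{x, y}\<close>, which
  \<open>edge\<close> forbids two indices to share.\<close>

lemma disjoint_paths_from_reachability:
  fixes Y :: "('w, 'w set) mgraph" and I :: "'i set"
  assumes ends: "ends Y = (\<lambda>m. m)" and "x \<noteq> y" and "finite I"
    and S: "\<And>i. i \<in> I \<Longrightarrow> x \<in> S i \<and> S i \<subseteq> verts Y"
    and E: "\<And>i. i \<in> I \<Longrightarrow> E i \<subseteq> edges Y"
    and reach: "\<And>i. i \<in> I \<Longrightarrow> (x, y) \<in> (adj_within (S i) (E i))\<^sup>*"
    and disj: "\<And>i j. i \<in> I \<Longrightarrow> j \<in> I \<Longrightarrow> i \<noteq> j \<Longrightarrow> S i \<inter> S j \<subseteq> {x, y}"
    and edge: "\<And>i j. i \<in> I \<Longrightarrow> j \<in> I \<Longrightarrow> i \<noteq> j \<Longrightarrow> {x, y} \<notin> E i \<inter> E j"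
  shows "\<exists>P. finite P \<and> card P = card I \<and> (\<forall>p\<in>P. is_path Y x p y) \<and>
            (\<forall>p\<in>P. \<forall>q\<in>P. p \<noteq> q \<longrightarrow> internal_verts p \<inter> internal_verts q = {})"
proof -
  have "\<exists>p. is_path Y x p y \<and> set (fst p) \<subseteq> S i \<and> set (snd p) \<subseteq> E i" if "i \<in> I" for i
    using path_from_reachability[OF ends] S E reach that by metis
  then obtain f where f: "\<And>i. i \<in> I \<Longrightarrow> is_path Y x (f i) y"
    "\<And>i. i \<in> I \<Longrightarrow> set (fst (f i)) \<subseteq> S i" "\<And>i. i \<in> I \<Longrightarrow> set (snd (f i)) \<subseteq> E i"
    by metis
  have int: "internal_verts (f i) \<inter> internal_verts (f j) = {}"
    if "i \<in> I" "j \<in> I" "i \<noteq> j" for i j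
  proof -
    have "internal_verts (f i) \<subseteq> S i - {x, y}" if "i \<in> I" for i
      using f(2)[OF that] unfolding is_path_internal_verts[OF f(1)[OF that]] by blast
    then show ?thesis using disj[OF that] that(1,2) by blast
  qed
  have "inj_on f I"
  proof (rule inj_onI, rule ccontr)
    fix i j assume ij: "i \<in> I" "j \<in> I" "f i = f j" "i \<noteq> j"
    have "internal_verts (f i) = {}" using int[OF ij(1,2,4)] ij(3) by simp
    then have "{x, y} \<in> set (snd (f i))"
      using is_path_no_internal_verts f(1) ij(1) \<open>x \<noteq> y\<close> ends by metis
    then show False using f(3)[OF ij(1)] f(3)[OF ij(2)] ij(3) edge[OF ij(1,2,4)] by auto
  qed
  then show ?thesis
    using \<open>finite I\<close> f(1) int
    by (intro exI[of _ "f ` I"]) (auto simp: card_image)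
qed

section \<open>Internally disjoint paths in a multigraph\<close>

lemma is_path_ends_subset:
  assumes "is_path X u p v" "e \<in> set (snd p)"
  shows "ends X e \<subseteq> set (fst p)"
proof -
  obtain i where i: "i < length (snd p)" "snd p ! i = e"
    using assms(2) by (auto simp: in_set_conv_nth)
  then have "ends X e = {fst p ! i, fst p ! Suc i}" "length (fst p) = Suc (length (snd p))"
    using assms(1) by (auto simp: is_path_def split: prod.splits)
  then show ?thesis using i(1) by simp
qed

text \<open>By distinctness \<open>u\<close> and \<open>v\<close> occur only at the first and the
  last position, so an edge between consecutive positions with ends among them is both the first and
  the last edge.\<close>

lemma is_path_edge_joining_ends:
  assumes "is_path X u (vs, es) v" "e \<in> set es" "ends X e \<subseteq> {u, v}"
  shows "(vs, es) = ([u, v], [e])"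
proof -
  have d: "length vs = Suc (length es)" "distinct vs" "hd vs = u" "last vs = v"
    "\<And>i. i < length es \<Longrightarrow> ends X (es ! i) = {vs ! i, vs ! Suc i}"
    using assms(1) by (auto simp: is_path_def)
  obtain i where i: "i < length es" "es ! i = e" using assms(2) by (auto simp: in_set_conv_nth)
  have ne: "vs \<noteq> []" using d(1) by auto
  have u: "u = vs ! 0" and v: "v = vs ! length es"
    using d ne by (auto simp: hd_conv_nth last_conv_nth)
  have idx: "vs ! a = vs ! b \<longleftrightarrow> a = b" if "a \<le> length es" "b \<le> length es" for a b
    using that d(1,2) by (simp add: nth_eq_iff_index_eq)
  have "{vs ! i, vs ! Suc i} \<subseteq> {vs ! 0, vs ! length es}"
    using d(5)[OF i(1)] i(2) assms(3) u v by simp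
  then have "i = 0" "Suc i = length es" using idx i(1) by auto
  then obtain e' where es: "es = [e']" by (cases es) auto
  obtain a b where "vs = [a, b]" using d(1) es by (auto simp: length_Suc_conv)
  then show ?thesis using i d(3,4) es by auto
qed

text \<open>The ends of a common edge lie on both paths, hence in \<open>{u, v}\<close>. Both paths
  then consist of this edge alone and coincide.\<close>

lemma internally_disjoint_imp_edge_disjoint:
  assumes "is_path X u p v" "is_path X u q v" "p \<noteq> q"
    and "internal_verts p \<inter> internal_verts q = {}"
  shows "set (snd p) \<inter> set (snd q) = {}"
proof (rule ccontr)
  assume "set (snd p) \<inter> set (snd q) \<noteq> {}"
  then obtain e where e: "e \<in> set (snd p)" "e \<in> set (snd q)" by auto
  have uv: "ends X e \<subseteq> {u, v}"
    using is_path_ends_subset[OF assms(1) e(1)] is_path_ends_subset[OF assms(2) e(2)] assms(4)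
    unfolding is_path_internal_verts[OF assms(1)] is_path_internal_verts[OF assms(2)] by blast
  have "p = ([u, v], [e])"
    using is_path_edge_joining_ends[of X u "fst p" "snd p" v e] assms(1) e(1) uv by simp
  moreover have "q = ([u, v], [e])"
    using is_path_edge_joining_ends[of X u "fst q" "snd q" v e] assms(2) e(2) uv by simp
  ultimately show False using assms(3) by simp
qed

text \<open>There are at least two internally disjoint paths, and \<open>v\<close>, being no end of
  them, lies on at most one of the two.\<close>

lemma k_connected_path_avoiding:
  assumes "k_connected k X" "k \<ge> 2" "u \<in> verts X" "w \<in> verts X" "u \<noteq> w" "v \<noteq> u" "v \<noteq> w"
  shows "\<exists>p. is_path X u p w \<and> v \<notin> set (fst p)"
proof -
  obtain P where P: "finite P" "card P = k" "\<And>p. p \<in> P \<Longrightarrow> is_path X u p w"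
    "\<And>p q. p \<in> P \<Longrightarrow> q \<in> P \<Longrightarrow> p \<noteq> q \<Longrightarrow> internal_verts p \<inter> internal_verts q = {}"
    using assms(1,3-5) unfolding k_connected_def by metis
  obtain p q where pq: "p \<in> P" "q \<in> P" "p \<noteq> q"
    using P(1,2) assms(2) by (metis card_le_Suc0_iff_eq not_less_eq_eq numeral_2_eq_2)
  have "v \<notin> set (fst p) \<or> v \<notin> set (fst q)"
    using P(4)[OF pq] assms(6,7)
    unfolding is_path_internal_verts[OF P(3)[OF pq(1)]] is_path_internal_verts[OF P(3)[OF pq(2)]]
    by blast
  then show ?thesis using P(3) pq(1,2) by blast
qed

lemma is_path_nonempty: "is_path X u p v \<Longrightarrow> u \<noteq> v \<Longrightarrow> snd p \<noteq> []"
  by (cases "fst p") (auto simp: is_path_def split: prod.splits)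

section \<open>The complete truncation\<close>

text \<open>The truncation data without \<open>con\<close>, which completeness determines from the
  clusters.\<close>

locale complete_truncation =
  fixes X :: "('v, 'e) mgraph" and M :: "'w set set" and F :: "'e \<Rightarrow> 'w set" and lab :: "'w \<Rightarrow> 'v"
  assumes multigraph: "multigraph X"
    and matching: "matching M"
    and bij_F: "bij_betw F (edges X) M"
    and bij_lab: "e \<in> edges X \<Longrightarrow> bij_betw lab (F e) (ends X e)"
begin

definition cluster_edges :: "'w set set" where
  "cluster_edges = (\<Union>v\<in>verts X. complete_edges (cluster M lab v))"

definition truncation :: "('w, 'w set) mgraph" where
  "truncation = \<lparr>verts = \<Union>M, edges = M \<union> cluster_edges, ends = (\<lambda>m. m)\<rparr>"

lemma truncation_simps [simp]:
  "verts truncation = \<Union>M" "edges truncation = M \<union> cluster_edges" "ends truncation = (\<lambda>m. m)"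
  by (auto simp: truncation_def)

section \<open>Matching edges, labels and clusters\<close>

lemma F_in_M: "e \<in> edges X \<Longrightarrow> F e \<in> M"
  using bij_F by (auto simp: bij_betw_def)

lemma F_disjoint: "e \<in> edges X \<Longrightarrow> f \<in> edges X \<Longrightarrow> e \<noteq> f \<Longrightarrow> F e \<inter> F f = {}"
  using matching F_in_M[of e] F_in_M[of f] inj_onD[OF bij_betw_imp_inj_on[OF bij_F], of e f]
  by (auto simp: matching_def disjoint_def)

lemma F_cover: "x \<in> \<Union>M \<Longrightarrow> \<exists>e\<in>edges X. x \<in> F e"
  using bij_F by (auto simp: bij_betw_def)

lemma lab_in_ends: "e \<in> edges X \<Longrightarrow> x \<in> F e \<Longrightarrow> lab x \<in> ends X e"
  using bij_lab by (auto simp: bij_betw_def)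

lemma lab_in_verts: "x \<in> \<Union>M \<Longrightarrow> lab x \<in> verts X"
  using F_cover[of x] lab_in_ends multigraph by (auto simp: multigraph_def)

lemma cluster_edgeI:
  assumes "a \<in> \<Union>M" "b \<in> \<Union>M" "lab a = lab b" "a \<noteq> b"
  shows "{a, b} \<in> cluster_edges"
  using assms lab_in_verts[of a]
  by (auto simp: cluster_edges_def complete_edges_def cluster_def)

lemma cluster_edges_lab: "{a, b} \<in> cluster_edges \<Longrightarrow> lab a = lab b"
  by (auto simp: cluster_edges_def complete_edges_def cluster_def)

text \<open>Lets the matching edge of \<open>e\<close> be traversed in the direction in which a path
  of \<open>X\<close> traverses \<open>e\<close>.\<close>

lemma F_eq_pair:
  assumes "e \<in> edges X" "ends X e = {u, v}"
  obtains a b where "F e = {a, b}" "lab a = u" "lab b = v" "a \<noteq> b"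
proof -
  have "card (ends X e) = 2" using multigraph assms(1) by (auto simp: multigraph_def)
  then have uv: "u \<noteq> v" using assms(2) by auto
  have b: "inj_on lab (F e)" "lab ` F e = {u, v}"
    using bij_lab[OF assms(1)] assms(2) by (auto simp: bij_betw_def)
  obtain a c where ac: "a \<in> F e" "c \<in> F e" "lab a = u" "lab c = v"
    using b(2) by (metis image_iff insertCI)
  have "F e = {a, c}"
  proof -
    have "z = a \<or> z = c" if z: "z \<in> F e" for z
    proof -
      have "lab z = lab a \<or> lab z = lab c" using b(2) z ac(3,4) by auto
      then show ?thesis using inj_onD[OF b(1)] z ac(1,2) by metis
    qed
    then show ?thesis using ac(1,2) by auto
  qed
  then show ?thesis using that ac uv by blast
qed

lemma other_end:
  assumes "x \<in> \<Union>M"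
  obtains e x' where "e \<in> edges X" "F e = {x, x'}" "lab x' \<noteq> lab x"
proof -
  obtain e where e: "e \<in> edges X" "x \<in> F e" using F_cover assms by blast
  have "card (ends X e) = 2" using multigraph e(1) by (auto simp: multigraph_def)
  then obtain u v where uv: "ends X e = {u, v}" "u \<noteq> v" by (auto simp: card_2_iff)
  obtain a b where "F e = {a, b}" "lab a = u" "lab b = v" using F_eq_pair[OF e(1) uv(1)] by blast
  then show ?thesis using e uv(2) that[of e a] that[of e b] by (auto simp: insert_commute)
qed

text \<open>The matching edges of the path are followed in order. The vertex where one of them ends
  and the vertex where the next begins share a label, so they lie in one cluster; the same holds for
  \<open>x\<close> and the first matching edge, and for the last one and \<open>y\<close>.\<close>

lemma lift_path:
  assumes p: "is_path X (lab x) (vs, es) (lab y)"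
    and x: "x \<in> \<Union>M" and y: "y \<in> \<Union>M"
  defines "R \<equiv> adj_within ({x, y} \<union> \<Union>(F ` set es)) (F ` set es \<union> cluster_edges)"
  shows "(x, y) \<in> R\<^sup>*"
proof -
  have d: "length vs = Suc (length es)" "set es \<subseteq> edges X" "hd vs = lab x" "last vs = lab y"
    "\<And>i. i < length es \<Longrightarrow> ends X (es ! i) = {vs ! i, vs ! Suc i}"
    using p by (auto simp: is_path_def)
  have vne: "vs \<noteq> []" using d(1) by auto
  define S where "S = {x, y} \<union> \<Union>(F ` set es)"
  have R: "R = adj_within S (F ` set es \<union> cluster_edges)" by (simp add: R_def S_def)
  have xS: "x \<in> S" "y \<in> S" by (auto simp: S_def)
  have FS: "F (es ! i) \<subseteq> S" if "i < length es" for i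
    using nth_mem[OF that] by (auto simp: S_def)
  have SM: "S \<subseteq> \<Union>M" using x y d(2) F_in_M by (auto simp: S_def)
  \<comment> \<open>The case \<open>a = b\<close> occurs, for instance, when \<open>x\<close> itself
    is an end of the first matching edge.\<close>
  have same: "(a, b) \<in> R\<^sup>*" if "a \<in> S" "b \<in> S" "lab a = lab b" for a b
  proof (cases "a = b")
    case False
    then have "{a, b} \<in> cluster_edges"
      using cluster_edgeI[OF subsetD[OF SM that(1)] subsetD[OF SM that(2)] that(3)] by simp
    then have "(a, b) \<in> R" using that unfolding R adj_within_def by simp
    then show ?thesis by (rule r_into_rtrancl)
  qed simp
  have pair: "\<exists>a b. F (es ! i) = {a, b} \<and> lab a = vs ! i \<and> lab b = vs ! Suc i \<and> (a, b) \<in> R"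
    if i: "i < length es" for i
  proof -
    obtain a b where ab: "F (es ! i) = {a, b}" "lab a = vs ! i" "lab b = vs ! Suc i"
      using F_eq_pair[OF subsetD[OF d(2) nth_mem[OF i]] d(5)[OF i]] by metis
    have "(a, b) \<in> R"
      using FS[OF i] imageI[OF nth_mem[OF i], of F] unfolding ab(1) R adj_within_def by simp
    then show ?thesis using ab by metis
  qed
  \<comment> \<open>Induction along the path of \<open>X\<close>: some vertex in the cluster of its
    \<open>i\<close>-th vertex is reachable from \<open>x\<close>.\<close>
  have reach: "\<exists>b\<in>S. lab b = vs ! i \<and> (x, b) \<in> R\<^sup>*" if "i \<le> length es" for i
    using that
  proof (induction i)
    case 0
    have "lab x = vs ! 0" using d(3) vne by (simp add: hd_conv_nth)
    then show ?case using xS(1) by (intro bexI[of _ x]) simp_all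
  next
    case (Suc i)
    then obtain c where c: "c \<in> S" "lab c = vs ! i" "(x, c) \<in> R\<^sup>*" by auto
    have i: "i < length es" using Suc.prems by simp
    obtain a b where ab: "F (es ! i) = {a, b}" "lab a = vs ! i" "lab b = vs ! Suc i" "(a, b) \<in> R"
      using pair[OF i] by metis
    have S: "a \<in> S" "b \<in> S" using FS[OF i] ab(1) by simp_all
    have "(c, a) \<in> R\<^sup>*" using same[OF c(1) S(1)] c(2) ab(2) by simp
    then have "(x, b) \<in> R\<^sup>*" using c(3) ab(4) by (meson rtrancl_into_rtrancl rtrancl_trans)
    then show ?case using S(2) ab(3) by (intro bexI[of _ b]) simp_all
  qed
  obtain b where b: "b \<in> S" "lab b = vs ! length es" "(x, b) \<in> R\<^sup>*" using reach[of "length es"] by auto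
  have "lab b = lab y" using b(2) d(1,4) vne by (simp add: last_conv_nth)
  then show ?thesis using same[OF b(1) xS(2)] b(3) by (meson rtrancl_trans)
qed

section \<open>Two vertices in different clusters\<close>

lemma disjoint_paths_between_clusters:
  assumes kc: "k_connected k X" and x: "x \<in> \<Union>M" and y: "y \<in> \<Union>M" and xy: "lab x \<noteq> lab y"
  shows "\<exists>P. finite P \<and> card P = k \<and> (\<forall>p\<in>P. is_path truncation x p y) \<and>
            (\<forall>p\<in>P. \<forall>q\<in>P. p \<noteq> q \<longrightarrow> internal_verts p \<inter> internal_verts q = {})"
proof -
  obtain P where P: "finite P" "card P = k" "\<And>p. p \<in> P \<Longrightarrow> is_path X (lab x) p (lab y)"
    "\<And>p q. p \<in> P \<Longrightarrow> q \<in> P \<Longrightarrow> p \<noteq> q \<Longrightarrow> internal_verts p \<inter> internal_verts q = {}"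
    using kc lab_in_verts[OF x] lab_in_verts[OF y] xy unfolding k_connected_def by metis
  have edX: "set (snd p) \<subseteq> edges X" if "p \<in> P" for p
    using P(3)[OF that] by (auto simp: is_path_def split: prod.splits)
  have ed: "set (snd p) \<inter> set (snd q) = {}" if "p \<in> P" "q \<in> P" "p \<noteq> q" for p q
    using internally_disjoint_imp_edge_disjoint P(3,4) that by metis
  \<comment> \<open>As \<open>M\<close> is a matching, edge-disjointness in \<open>X\<close> becomes
    vertex-disjointness in the truncation.\<close>
  have Fd: "\<Union>(F ` set (snd p)) \<inter> \<Union>(F ` set (snd q)) = {}" if "p \<in> P" "q \<in> P" "p \<noteq> q" for p q
  proof -
    have "F e \<inter> F f = {}" if "e \<in> set (snd p)" "f \<in> set (snd q)" for e f
      using that ed[OF \<open>p \<in> P\<close> \<open>q \<in> P\<close> \<open>p \<noteq> q\<close>] edX \<open>p \<in> P\<close> \<open>q \<in> P\<close>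
      by (intro F_disjoint) blast+
    then show ?thesis by blast
  qed
  have "\<exists>Q. finite Q \<and> card Q = card P \<and> (\<forall>p\<in>Q. is_path truncation x p y) \<and>
            (\<forall>p\<in>Q. \<forall>q\<in>Q. p \<noteq> q \<longrightarrow> internal_verts p \<inter> internal_verts q = {})"
  proof (rule disjoint_paths_from_reachability[where
        S = "\<lambda>p. {x, y} \<union> \<Union>(F ` set (snd p))" and E = "\<lambda>p. F ` set (snd p) \<union> cluster_edges"])
    show "(x, y) \<in> (adj_within ({x, y} \<union> \<Union>(F ` set (snd p))) (F ` set (snd p) \<union> cluster_edges))\<^sup>*"
      if "p \<in> P" for p
      using lift_path[of x "fst p" "snd p" y] P(3)[OF that] x y
      by simp
    show "{x, y} \<notin> (F ` set (snd p) \<union> cluster_edges) \<inter> (F ` set (snd q) \<union> cluster_edges)"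
      if "p \<in> P" "q \<in> P" "p \<noteq> q" for p q
    proof -
      \<comment> \<open>The cluster edges are allowed to every path, but \<open>{x, y}\<close> is
        none of them because the labels differ. As a matching edge it belongs to at most one
        path.\<close>
      have "{x, y} \<notin> F ` set (snd p) \<or> {x, y} \<notin> F ` set (snd q)"
        using Fd[OF that] by (metis IntI UnionI empty_iff insertI1)
      then show ?thesis using cluster_edges_lab[of x y] xy by auto
    qed
    show "({x, y} \<union> \<Union>(F ` set (snd p))) \<inter> ({x, y} \<union> \<Union>(F ` set (snd q))) \<subseteq> {x, y}"
      if "p \<in> P" "q \<in> P" "p \<noteq> q" for p q
      using Fd[OF that] by blast
    show "x \<in> {x, y} \<union> \<Union>(F ` set (snd p)) \<and> {x, y} \<union> \<Union>(F ` set (snd p)) \<subseteq> verts truncation"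
      if "p \<in> P" for p
      using x y edX[OF that] F_in_M by auto
    show "F ` set (snd p) \<union> cluster_edges \<subseteq> edges truncation" if "p \<in> P" for p
      using edX[OF that] F_in_M by auto
  qed (use xy P(1) in auto)
  then show ?thesis using P(2) by simp
qed

section \<open>Two vertices in the same cluster\<close>

lemma large_cluster:
  assumes kc: "k_connected k X" and v: "v \<in> verts X"
  obtains C where "C \<subseteq> cluster M lab v" "finite C" "card C = k"
proof -
  obtain e where e: "e \<in> edges X" "v \<in> ends X e" using v multigraph by (auto simp: multigraph_def)
  have "card (ends X e) = 2" "ends X e \<subseteq> verts X"
    using multigraph e(1) by (auto simp: multigraph_def)
  then obtain a b where "a \<noteq> b" "a \<in> verts X" "b \<in> verts X" by (auto simp: card_2_iff)
  \<comment> \<open>An edge at \<open>v\<close> has two different ends, so \<open>X\<close> has a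
    vertex other than \<open>v\<close>.\<close>
  then obtain w where w: "w \<in> verts X" "w \<noteq> v" by metis
  obtain P where P: "finite P" "card P = k" "\<And>p. p \<in> P \<Longrightarrow> is_path X v p w"
    "\<And>p q. p \<in> P \<Longrightarrow> q \<in> P \<Longrightarrow> p \<noteq> q \<Longrightarrow> internal_verts p \<inter> internal_verts q = {}"
    using kc v w unfolding k_connected_def by metis
  \<comment> \<open>The first edge of each path is incident with \<open>v\<close>; the end of its
    matching edge labelled \<open>v\<close> is the vertex that this path contributes to the
    cluster.\<close>
  have "\<exists>a. \<exists>e\<in>set (snd p). e \<in> edges X \<and> a \<in> F e \<and> lab a = v" if "p \<in> P" for p
  proof -
    obtain vs es where p: "p = (vs, es)" by force
    have ne: "es \<noteq> []" using is_path_nonempty[OF P(3)[OF that] w(2)[symmetric]] p by simp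
    have d: "length vs = Suc (length es)" "set es \<subseteq> edges X" "hd vs = v"
      "\<And>i. i < length es \<Longrightarrow> ends X (es ! i) = {vs ! i, vs ! Suc i}"
      using P(3)[OF that] by (auto simp: is_path_def p)
    have "vs \<noteq> []" using d(1) by auto
    then have "ends X (es ! 0) = {v, vs ! 1}" using d(3,4) ne by (auto simp: hd_conv_nth)
    moreover have e0: "es ! 0 \<in> set es" using ne by simp
    ultimately obtain a b where "F (es ! 0) = {a, b}" "lab a = v"
      using F_eq_pair[OF subsetD[OF d(2) e0]] by metis
    then show ?thesis
      using e0 subsetD[OF d(2) e0] p by (intro exI[of _ a] bexI[of _ "es ! 0"]) simp_all
  qed
  then obtain h where h: "\<And>p. p \<in> P \<Longrightarrow> \<exists>e\<in>set (snd p). e \<in> edges X \<and> h p \<in> F e \<and> lab (h p) = v"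
    by metis
  \<comment> \<open>Different paths are edge-disjoint, and different edges have disjoint matching
    edges.\<close>
  have "inj_on h P"
  proof (rule inj_onI, rule ccontr)
    fix p q assume pq: "p \<in> P" "q \<in> P" "h p = h q" "p \<noteq> q"
    obtain e f where "e \<in> set (snd p)" "e \<in> edges X" "h p \<in> F e"
      "f \<in> set (snd q)" "f \<in> edges X" "h p \<in> F f"
      using h[OF pq(1)] h[OF pq(2)] pq(3) by auto
    then show False
      using internally_disjoint_imp_edge_disjoint[OF P(3)[OF pq(1)] P(3)[OF pq(2)] pq(4) P(4)[OF pq(1,2,4)]]
        F_disjoint[of e f] by (cases "e = f") auto
  qed
  then have "card (h ` P) = k" using P(2) by (simp add: card_image)
  moreover have "h ` P \<subseteq> cluster M lab v"
  proof (rule image_subsetI)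
    fix p assume "p \<in> P"
    then obtain e where "e \<in> edges X" "h p \<in> F e" "lab (h p) = v" using h by metis
    then show "h p \<in> cluster M lab v" using F_in_M by (auto simp: cluster_def)
  qed
  ultimately show ?thesis using that[of "h ` P"] P(1) by simp
qed

text \<open>The edge \<open>{x, y}\<close> is deleted so that this route cannot become the path
  along that edge, which is counted separately.\<close>

lemma reachable_outside_cluster:
  assumes kc: "k_connected k X" and k: "k \<ge> 2"
    and x: "x \<in> \<Union>M" and y: "y \<in> \<Union>M" and xy: "x \<noteq> y" "lab x = lab y"
  obtains S where "S \<subseteq> \<Union>M" "\<And>s. s \<in> S \<Longrightarrow> lab s \<noteq> lab x"
    "(x, y) \<in> (adj_within ({x, y} \<union> S) (M \<union> cluster_edges - {{x, y}}))\<^sup>*"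
proof -
  obtain e x' where e: "e \<in> edges X" "F e = {x, x'}" "lab x' \<noteq> lab x" using other_end[OF x] by blast
  obtain f y' where f: "f \<in> edges X" "F f = {y, y'}" "lab y' \<noteq> lab y" using other_end[OF y] by blast
  have x': "x' \<in> \<Union>M" and y': "y' \<in> \<Union>M" using e f F_in_M by blast+
  obtain T where T: "T \<subseteq> \<Union>M" "x' \<in> T" "y' \<in> T" "\<And>s. s \<in> T \<Longrightarrow> lab s \<noteq> lab x"
    "(x', y') \<in> (adj_within T (M \<union> cluster_edges))\<^sup>*"
  proof (cases "lab x' = lab y'")
    case True
    \<comment> \<open>Here \<open>e\<close> and \<open>f\<close> are parallel edges of
      \<open>X\<close>, and the route stays in the cluster of \<open>x'\<close> and
      \<open>y'\<close>.\<close>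
    have "(x', y') \<in> (adj_within {x', y'} (M \<union> cluster_edges))\<^sup>*"
    proof (cases "x' = y'")
      case False
      then have "(x', y') \<in> adj_within {x', y'} (M \<union> cluster_edges)"
        using cluster_edgeI[OF x' y' True] by (simp add: adj_within_def)
      then show ?thesis by blast
    qed simp
    then show ?thesis using that[of "{x', y'}"] x' y' e(3) f(3) xy(2) by auto
  next
    case False
    obtain p where p: "is_path X (lab x') p (lab y')" "lab x \<notin> set (fst p)"
      using k_connected_path_avoiding[OF kc k lab_in_verts[OF x'] lab_in_verts[OF y'] False]
        e(3) f(3) xy(2) by metis
    obtain vs es where ve: "p = (vs, es)" by force
    let ?T = "{x', y'} \<union> \<Union>(F ` set es)"
    have es: "set es \<subseteq> edges X" using p(1) by (auto simp: is_path_def ve)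
    have sub: "ends X g \<subseteq> set vs" if "g \<in> set es" for g
      using is_path_ends_subset[OF p(1)] that by (simp add: ve)
    have "(x', y') \<in> (adj_within ?T (F ` set es \<union> cluster_edges))\<^sup>*"
      using lift_path[OF p(1)[unfolded ve] x' y'] .
    moreover have "F ` set es \<union> cluster_edges \<subseteq> M \<union> cluster_edges" using es F_in_M by blast
    ultimately have "(x', y') \<in> (adj_within ?T (M \<union> cluster_edges))\<^sup>*"
      using rtrancl_mono[OF adj_within_mono[OF subset_refl]] by blast
    \<comment> \<open>The labels of the ends of \<open>F g\<close> are ends of \<open>g\<close>,
      hence vertices of \<open>p\<close>, and \<open>p\<close> avoids \<open>lab x\<close>.\<close>
    moreover have "lab s \<noteq> lab x" if s: "s \<in> ?T" for s
    proof (cases "s \<in> {x', y'}")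
      case True
      then show ?thesis using e(3) f(3) xy(2) by auto
    next
      case False
      then obtain g where g: "g \<in> set es" "s \<in> F g" using s by auto
      then have "lab s \<in> set vs" using lab_in_ends es sub by blast
      then show ?thesis using p(2) ve by auto
    qed
    moreover have "?T \<subseteq> \<Union>M" using x' y' es F_in_M by blast
    ultimately show ?thesis using that by blast
  qed
  let ?E = "M \<union> cluster_edges - {{x, y}}"
  have xT: "x \<notin> T" using T(4) by auto
  \<comment> \<open>Since \<open>x\<close> is not in \<open>T\<close>, no edge inside
    \<open>T\<close> is \<open>{x, y}\<close>, and the deletion does no harm.\<close>
  have "adj_within T (M \<union> cluster_edges) \<subseteq> adj_within ({x, y} \<union> T) ?E"
    using xT by (auto simp: adj_within_def doubleton_eq_iff)
  then have "(x', y') \<in> (adj_within ({x, y} \<union> T) ?E)\<^sup>*" using T(5) rtrancl_mono by blast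
  moreover have "(x, x') \<in> adj_within ({x, y} \<union> T) ?E"
    using F_in_M[OF e(1)] e T(2) xy by (auto simp: adj_within_def doubleton_eq_iff)
  moreover have "(y', y) \<in> adj_within ({x, y} \<union> T) ?E"
    using F_in_M[OF f(1)] f T(3) xy by (auto simp: adj_within_def doubleton_eq_iff insert_commute)
  ultimately have "(x, y) \<in> (adj_within ({x, y} \<union> T) ?E)\<^sup>*"
    by (meson converse_rtrancl_into_rtrancl rtrancl_into_rtrancl)
  then show ?thesis using that T(1,4) by blast
qed

lemma disjoint_paths_within_cluster:
  assumes kc: "k_connected k X" and k: "k \<ge> 2"
    and x: "x \<in> \<Union>M" and y: "y \<in> \<Union>M" and xy: "x \<noteq> y" "lab x = lab y"
  shows "\<exists>P. finite P \<and> card P = k \<and> (\<forall>p\<in>P. is_path truncation x p y) \<and>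
            (\<forall>p\<in>P. \<forall>q\<in>P. p \<noteq> q \<longrightarrow> internal_verts p \<inter> internal_verts q = {})"
proof -
  obtain T where T: "T \<subseteq> \<Union>M" "\<And>s. s \<in> T \<Longrightarrow> lab s \<noteq> lab x"
    "(x, y) \<in> (adj_within ({x, y} \<union> T) (M \<union> cluster_edges - {{x, y}}))\<^sup>*"
    using reachable_outside_cluster[OF kc k x y xy] by blast
  obtain D where D: "D \<subseteq> cluster M lab (lab x)" "finite D" "card D = k"
    using large_cluster[OF kc lab_in_verts[OF x]] by blast
  \<comment> \<open>Whether or not \<open>x\<close> and \<open>y\<close> belong to \<open>D\<close>,
    at least \<open>k - 2\<close> other vertices remain as midpoints.\<close>
  have "k - 2 \<le> card (D - {x, y})"
    using diff_card_le_card_Diff[of "{x, y}" D] D(3) xy(1) by simp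
  then obtain C where C: "C \<subseteq> D - {x, y}" "card C = k - 2" "finite C"
    using obtain_subset_with_card_n by metis
  have Cc: "c \<in> \<Union>M \<and> lab c = lab x \<and> c \<noteq> x \<and> c \<noteq> y" if "c \<in> C" for c
    using that C(1) D(1) by (auto simp: cluster_def)
  \<comment> \<open>The index \<open>x\<close> stands for the path along the edge \<open>xy\<close>, the index \<open>y\<close> for the path outside
    the cluster, and \<open>c \<in> C\<close> for the path \<open>x c y\<close>.\<close>
  let ?I = "insert x (insert y C)"
  let ?S = "\<lambda>i. {x, y} \<union> (if i = x then {} else if i = y then T else {i})"
  let ?E = "\<lambda>i. if i = x then {{x, y}} else M \<union> cluster_edges - {{x, y}}"
  \<comment> \<open>The indices \<open>x\<close> and \<open>y\<close> are different and outside
    \<open>C\<close>, and \<open>k - 2\<close> is not truncated because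
    \<open>k \<ge> 2\<close>.\<close>
  have "card ?I = k" using Cc C(2,3) xy(1) k by (auto simp: card_insert_if)
  have "\<exists>P. finite P \<and> card P = card ?I \<and> (\<forall>p\<in>P. is_path truncation x p y) \<and>
            (\<forall>p\<in>P. \<forall>q\<in>P. p \<noteq> q \<longrightarrow> internal_verts p \<inter> internal_verts q = {})"
  proof (rule disjoint_paths_from_reachability[where S = ?S and E = ?E])
    show "(x, y) \<in> (adj_within (?S i) (?E i))\<^sup>*" if "i \<in> ?I" for i
    proof -
      consider "i = x" | "i = y" | "i \<in> C" using \<open>i \<in> ?I\<close> by blast
      then show ?thesis
      proof cases
        case 1
        then have "(x, y) \<in> adj_within (?S i) (?E i)" by (simp add: adj_within_def)
        then show ?thesis by blast
      next
        case 2
        then show ?thesis using T(3) xy(1) by simp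
      next
        case 3
        note i = Cc[OF 3]
        have "{x, i} \<in> cluster_edges" "{i, y} \<in> cluster_edges"
          using cluster_edgeI x y i xy(2) by metis+
        then have "(x, i) \<in> adj_within (?S i) (?E i)" "(i, y) \<in> adj_within (?S i) (?E i)"
          using i by (auto simp: adj_within_def doubleton_eq_iff)
        then show ?thesis by (meson converse_rtrancl_into_rtrancl r_into_rtrancl)
      qed
    qed
    \<comment> \<open>The vertices of \<open>C\<close> have the label of \<open>x\<close>, while
      those of \<open>T\<close> have other labels.\<close>
    show "?S i \<inter> ?S j \<subseteq> {x, y}" if "i \<in> ?I" "j \<in> ?I" "i \<noteq> j" for i j
      using that Cc T(2) by (auto split: if_splits)
    show "x \<in> ?S i \<and> ?S i \<subseteq> verts truncation" if "i \<in> ?I" for i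
      using that x y T(1) Cc by auto
    show "?E i \<subseteq> edges truncation" if "i \<in> ?I" for i
      using cluster_edgeI[OF x y xy(2,1)] by auto
  qed (use xy(1) C(3) in auto)
  then show ?thesis using \<open>card ?I = k\<close> by simp
qed

section \<open>Connectivity of the truncation\<close>

lemma k_connected_truncation:
  assumes "k_connected k X" "k \<ge> 2"
  shows "k_connected k truncation"
  unfolding k_connected_def truncation_simps
  using disjoint_paths_between_clusters[OF assms(1)] disjoint_paths_within_cluster[OF assms]
  by blast

end

theorem theorem3p8:
  fixes X :: "('v, 'e) mgraph" and Y :: "('w, 'w set) mgraph" and k :: nat
  assumes "k \<ge> 2"
    and "multigraph X"
    and "k_connected k X"
    and "complete_generalized_truncation X Y"
  shows "k_connected k Y"
proof -
  obtain M F lab con where t: "truncation_data X M F lab con Y"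
    and con: "\<And>v. v \<in> verts X \<Longrightarrow> con v = complete_edges (cluster M lab v)"
    using assms(4) unfolding complete_generalized_truncation_def by blast
  interpret complete_truncation X M F lab
    using t assms(2) by unfold_locales (auto simp: truncation_data_def)
  \<comment> \<open>Completeness makes the union of the constituents equal to
    \<open>cluster_edges\<close>.\<close>
  have "Y = truncation"
    using t con by (simp add: truncation_data_def truncation_def cluster_edges_def)
  then show ?thesis using k_connected_truncation assms(1,3) by simp
qed

end
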